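(* There is a compact metric space $X$ with lower Minkowski dimension equal to $1$, all of whose proper closed subsets have lower Minkowski dimension $0$.
   Context: The lower Minkowski dimension of a nonempty compact metric space $Z$ is $\liminf_{\varepsilon\to0}\frac{\log N(\varepsilon)}{\log(1/\varepsilon)}$, where $N(\varepsilon)$ is the least number of balls of radius $\varepsilon$ needed to cover $Z$; by convention the empty set has dimension $0$. Subsets of $X$ carry the restricted metric. *)

theory Defs
  imports "HOL-Analysis.Analysis"
begin

(* Balls are open and centred at points of the space; open versus closed balls makes no
   difference to the dimension below. The LEAST is over a nonempty set of numbers whenever
   X is totally bounded, in particular whenever X is compact. *)
definition covering_number :: "'a metric \<Rightarrow> real \<Rightarrow> nat" where
  "covering_number X \<epsilon> =
     (LEAST n. \<exists>C. finite C \<and> card C = n \<and> C \<subseteq> mspace X \<and>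
                   mspace X \<subseteq> (\<Union>x\<in>C. mball_of X x \<epsilon>))"

(* Extended-real-valued, as the lower limit may be infinite. *)
definition lower_minkowski_dim :: "'a metric \<Rightarrow> ereal" where
  "lower_minkowski_dim X =
     (if mspace X = {} then 0
      else Liminf (at_right 0)
             (\<lambda>\<epsilon>. ereal (ln (real (covering_number X \<epsilon>)) / ln (1 / \<epsilon>))))"

(* HOL cannot quantify existentially over types, so an underlying type must be chosen when
   asserting the existence of a compact metric space. A compact metric space has at most
   continuum many points, hence is isometric to some X :: (nat => nat) metric: both the
   carrier mspace X and the distance mdist X are arbitrary and unrelated to any topology
   on nat => nat. *)
type_synonym continuum_metric = "(nat \<Rightarrow> nat) metric"

end

theory Submission
  imports Defs "HOL-Real_Asymp.Real_Asymp"
begin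

text \<open>
  The space is the set of ends of a rooted tree with exactly one branching at each level, so that
  level \<open>n\<close> has \<open>n + 1\<close> nodes. With two ends separating at level \<open>n\<close> put at distance \<open>1/n\<close>, the
  covering number at scale \<open>\<epsilon>\<close> is \<open>\<lfloor>1/\<epsilon>\<rfloor> + 1\<close>, whence the dimension is \<open>1\<close>. There is freedom in
  choosing which node branches: from level \<open>g k\<close> to the far larger level \<open>g (k+1)\<close> all branchings
  happen below one node, and every node has this role infinitely often. A proper closed subset
  misses some node; in the stages devoted to that node it does not branch at all, so at scale
  \<open>1 / g (k+1)\<close> it is covered by \<open>g k + 1\<close> balls, which is negligible on the logarithmic scale.
\<close>

text \<open>
  A node at level \<open>n\<close> is labelled by the last level at which its path turned into a newly created
  branch, so the labels at level \<open>n\<close> are \<open>0..n\<close>. The branch created at level \<open>n\<close> splits off the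
  node labelled \<open>p n\<close>, and an end is identified with its sequence of labels.
\<close>

definition ends :: "(nat \<Rightarrow> nat) \<Rightarrow> (nat \<Rightarrow> nat) set" where
  "ends p = {x. x 0 = 0 \<and>
     (\<forall>n. x (Suc n) = x n \<or> (x (Suc n) = Suc n \<and> x n = p (Suc n)))}"

text \<open>All ends start at \<open>0\<close>, so distinct ends first differ at a positive level;
  the value \<open>1 / 0 = 0\<close> can arise only outside \<open>ends p\<close>.\<close>

definition ends_dist :: "(nat \<Rightarrow> nat) \<Rightarrow> (nat \<Rightarrow> nat) \<Rightarrow> real" where
  "ends_dist x y = (if x = y then 0 else 1 / real (LEAST n. x n \<noteq> y n))"

definition ends_metric :: "(nat \<Rightarrow> nat) \<Rightarrow> (nat \<Rightarrow> nat) metric" where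
  "ends_metric p = metric (ends p, ends_dist)"

section \<open>Combinatorics of labels along an end\<close>

lemma ends_0: "x \<in> ends p \<Longrightarrow> x 0 = 0"
  by (simp add: ends_def)

lemma ends_Suc:
  "x \<in> ends p \<Longrightarrow> x (Suc n) = x n \<or> (x (Suc n) = Suc n \<and> x n = p (Suc n))"
  by (simp add: ends_def)

lemma ends_le: "x \<in> ends p \<Longrightarrow> x n \<le> n"
proof (induction n)
  case (Suc n)
  then show ?case using ends_Suc[of x p n] by auto
qed (simp add: ends_0)

text \<open>A label \<open>Suc n\<close> exceeds all labels at level \<open>n\<close>, so it signals
  a turn out of \<open>p (Suc n)\<close>; any other label is inherited. Hence one label determines
  its predecessor and, by iteration, the whole path from the root.\<close>

lemma ends_eq_Suc:
  assumes "x \<in> ends p" "y \<in> ends p" "x (Suc n) = y (Suc n)"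
  shows "x n = y n"
proof -
  have "x n \<le> n" "y n \<le> n" using assms ends_le by auto
  then show ?thesis
    using ends_Suc[OF assms(1), of n] ends_Suc[OF assms(2), of n] assms(3) by auto
qed

lemma ends_eq_mono:
  assumes "x \<in> ends p" "y \<in> ends p" "m \<le> n" "x n = y n"
  shows "x m = y m"
  using assms(3,4)
  by (induction rule: inc_induct) (auto dest: ends_eq_Suc[OF assms(1,2)])

text \<open>On the way to level \<open>Suc m\<close> a label changes only by becoming
  \<open>Suc m\<close>, so a label \<open>l\<close> cannot be acquired after level
  \<open>l\<close>.\<close>

lemma ends_label_stable:
  assumes "x \<in> ends p" "x n = l" "l \<le> m" "m \<le> n"
  shows "x m = l"
  using assms(4,2,3)
proof (induction rule: inc_induct)
  case (step m)
  then have "x (Suc m) = l" by simp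
  with ends_Suc[OF assms(1), of m] \<open>l \<le> m\<close> show ?case by auto
qed

section \<open>The ultrametric and its balls\<close>

lemma ends_dist_eq_0_iff: "x \<in> ends p \<Longrightarrow> y \<in> ends p \<Longrightarrow> ends_dist x y = 0 \<longleftrightarrow> x = y"
proof -
  assume x: "x \<in> ends p" and y: "y \<in> ends p"
  have "(LEAST n. x n \<noteq> y n) \<noteq> 0" if "x \<noteq> y"
  proof -
    from that obtain n where "x n \<noteq> y n" by blast
    then have "x (LEAST n. x n \<noteq> y n) \<noteq> y (LEAST n. x n \<noteq> y n)" by (rule LeastI)
    then show ?thesis using x y by (metis ends_0)
  qed
  then show ?thesis by (auto simp: ends_dist_def)
qed

text \<open>Agreement propagates to all lower levels, so ends with first difference \<open>L\<close>
  agree exactly below \<open>L\<close>, and \<open>1 / L < \<epsilon>\<close> means that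
  \<open>L\<close> exceeds the floor of \<open>1 / \<epsilon>\<close>. A ball is thus the set of
  ends through one node.\<close>

lemma ends_dist_less_iff:
  assumes x: "x \<in> ends p" and y: "y \<in> ends p" and "0 < \<epsilon>"
  shows "ends_dist x y < \<epsilon> \<longleftrightarrow> x (nat \<lfloor>1/\<epsilon>\<rfloor>) = y (nat \<lfloor>1/\<epsilon>\<rfloor>)"
proof (cases "x = y")
  case True
  then show ?thesis using \<open>0 < \<epsilon>\<close> by (simp add: ends_dist_def)
next
  case False
  define L where "L = (LEAST n. x n \<noteq> y n)"
  from False obtain n where "x n \<noteq> y n" by blast
  then have L: "x L \<noteq> y L" unfolding L_def by (rule LeastI)
  have "L \<noteq> 0" using L x y by (metis ends_0)
  have dist: "ends_dist x y = 1 / real L" using False by (simp add: ends_dist_def L_def)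
  have eq_iff: "x n = y n \<longleftrightarrow> n < L" for n
  proof
    assume "n < L"
    then show "x n = y n" using not_less_Least unfolding L_def by blast
  next
    assume "x n = y n"
    then show "n < L" using ends_eq_mono[OF x y, of L n] L by (meson not_le)
  qed
  have "ends_dist x y < \<epsilon> \<longleftrightarrow> 1 / \<epsilon> < real L"
    using \<open>0 < \<epsilon>\<close> \<open>L \<noteq> 0\<close> by (simp add: dist field_simps)
  also have "\<dots> \<longleftrightarrow> nat \<lfloor>1/\<epsilon>\<rfloor> < L"
    using \<open>0 < \<epsilon>\<close> by (simp add: nat_less_iff floor_less_iff)
  finally show ?thesis by (simp add: eq_iff)
qed

lemma Metric_space_ends: "Metric_space (ends p) ends_dist"
proof
  fix x y :: "nat \<Rightarrow> nat"
  show "0 \<le> ends_dist x y" by (simp add: ends_dist_def)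
  show "ends_dist x y = ends_dist y x" by (simp add: ends_dist_def eq_commute)
next
  fix x y assume "x \<in> ends p" "y \<in> ends p"
  then show "(ends_dist x y = 0) = (x = y)" by (rule ends_dist_eq_0_iff)
next
  fix x y z assume x: "x \<in> ends p" and y: "y \<in> ends p" and z: "z \<in> ends p"
  show "ends_dist x z \<le> ends_dist x y + ends_dist y z"
  proof (rule ccontr)
    assume "\<not> ?thesis"
    moreover have "0 \<le> ends_dist x y" "0 \<le> ends_dist y z" by (simp_all add: ends_dist_def)
    ultimately have "0 < ends_dist x z" "ends_dist x y < ends_dist x z"
      "ends_dist y z < ends_dist x z" by auto
    \<comment> \<open>At the level belonging to the radius \<open>ends_dist x z\<close>, agreement
      is transitive through \<open>y\<close>; this is the argument for the ultrametric
      inequality.\<close>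
    note less_iff = ends_dist_less_iff[OF _ _ this(1)]
    have "x (nat \<lfloor>1 / ends_dist x z\<rfloor>) = z (nat \<lfloor>1 / ends_dist x z\<rfloor>)"
      using less_iff[OF x y] less_iff[OF y z] \<open>ends_dist x y < ends_dist x z\<close>
        \<open>ends_dist y z < ends_dist x z\<close> by argo
    then show False using less_iff[OF x z] by blast
  qed
qed

lemma mspace_ends_metric [simp]: "mspace (ends_metric p) = ends p"
  unfolding ends_metric_def by (rule Metric_space.mspace_metric[OF Metric_space_ends])

lemma mdist_ends_metric [simp]: "mdist (ends_metric p) = ends_dist"
  unfolding ends_metric_def by (rule Metric_space.mdist_metric[OF Metric_space_ends])

section \<open>Covering numbers as label counts\<close>

lemma finite_labels:
  assumes "A \<subseteq> ends p"
  shows "finite ((\<lambda>x. x n) ` A)"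
proof (rule finite_subset)
  show "(\<lambda>x. x n) ` A \<subseteq> {..n}" using assms ends_le by fastforce
qed simp

text \<open>Supplies ball centres, one for each node that \<open>A\<close> meets; they are taken
  from \<open>A\<close> because covers of a subspace must be centred in it.\<close>

lemma finite_transversal:
  assumes "A \<subseteq> ends p"
  obtains C where "C \<subseteq> A" "finite C" "card C = card ((\<lambda>x. x n) ` A)"
    "(\<lambda>x. x n) ` C = (\<lambda>x. x n) ` A"
proof -
  obtain C where "C \<subseteq> A" "inj_on (\<lambda>x. x n) C" "(\<lambda>x. x n) ` A = (\<lambda>x. x n) ` C"
    by (meson subset_image_inj order_refl)
  with finite_labels[OF assms, of n] show thesis
    by (intro that[of C]) (auto simp: card_image finite_image_iff)
qed

text \<open>Balls are the fibres of the label map at level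
  \<open>nat \<lfloor>1/\<epsilon>\<rfloor>\<close>, so a cover has to have a centre in each fibre,
  and a transversal is enough.\<close>

lemma covering_number_ends:
  assumes A: "A \<subseteq> ends p" and "0 < \<epsilon>"
  shows "covering_number (submetric (ends_metric p) A) \<epsilon> = card ((\<lambda>x. x (nat \<lfloor>1/\<epsilon>\<rfloor>)) ` A)"
proof -
  define n where "n = nat \<lfloor>1/\<epsilon>\<rfloor>"
  have ball: "y \<in> mball_of (submetric (ends_metric p) A) x \<epsilon> \<longleftrightarrow> x \<in> A \<and> y \<in> A \<and> x n = y n" for x y
    using A ends_dist_less_iff[OF _ _ \<open>0 < \<epsilon>\<close>, of x p y] by (auto simp: n_def)
  have A_Int: "A \<inter> ends p = A" using A by blast
  show ?thesis
    unfolding covering_number_def n_def[symmetric]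
  proof (rule Least_equality)
    obtain C where "C \<subseteq> A" "finite C" "card C = card ((\<lambda>x. x n) ` A)"
      "(\<lambda>x. x n) ` C = (\<lambda>x. x n) ` A"
      using finite_transversal[OF A] .
    moreover have "A \<subseteq> (\<Union>x\<in>C. mball_of (submetric (ends_metric p) A) x \<epsilon>)"
    proof
      fix y assume "y \<in> A"
      then have "y n \<in> (\<lambda>x. x n) ` C" using calculation(4) by blast
      then obtain x where "x \<in> C" "x n = y n" by (metis imageE)
      then have "y \<in> mball_of (submetric (ends_metric p) A) x \<epsilon>"
        using ball[of y x] \<open>y \<in> A\<close> \<open>C \<subseteq> A\<close> by blast
      with \<open>x \<in> C\<close> show "y \<in> (\<Union>x\<in>C. mball_of (submetric (ends_metric p) A) x \<epsilon>)"
        by blast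
    qed
    ultimately show "\<exists>C. finite C \<and> card C = card ((\<lambda>x. x n) ` A) \<and>
        C \<subseteq> mspace (submetric (ends_metric p) A) \<and>
        mspace (submetric (ends_metric p) A) \<subseteq> (\<Union>x\<in>C. mball_of (submetric (ends_metric p) A) x \<epsilon>)"
      by (simp add: A_Int) blast
  next
    fix m
    assume "\<exists>C. finite C \<and> card C = m \<and> C \<subseteq> mspace (submetric (ends_metric p) A) \<and>
        mspace (submetric (ends_metric p) A) \<subseteq> (\<Union>x\<in>C. mball_of (submetric (ends_metric p) A) x \<epsilon>)"
    then obtain C where C: "finite C" "card C = m"
      "A \<subseteq> (\<Union>x\<in>C. mball_of (submetric (ends_metric p) A) x \<epsilon>)"
      by (auto simp: A_Int)
    have "(\<lambda>x. x n) ` A \<subseteq> (\<lambda>x. x n) ` C"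
    proof (rule image_subsetI)
      fix y assume "y \<in> A"
      with C(3) obtain x where "x \<in> C" "y \<in> mball_of (submetric (ends_metric p) A) x \<epsilon>" by blast
      then show "y n \<in> (\<lambda>x. x n) ` C" using ball by (metis image_eqI)
    qed
    then have "card ((\<lambda>x. x n) ` A) \<le> card ((\<lambda>x. x n) ` C)" using C(1) by (simp add: card_mono)
    also have "\<dots> \<le> m" using C card_image_le by blast
    finally show "card ((\<lambda>x. x n) ` A) \<le> m" .
  qed
qed

section \<open>Compactness\<close>

lemma compact_space_ends: "compact_space (mtopology_of (ends_metric p))"
proof -
  interpret Metric_space "ends p" ends_dist by (rule Metric_space_ends)
  have "mtotally_bounded (ends p)"
    unfolding mtotally_bounded_def
  proof (intro allI impI)
    fix \<epsilon> :: real assume "0 < \<epsilon>"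
    define n where "n = nat \<lfloor>1/\<epsilon>\<rfloor>"
    obtain C where C: "C \<subseteq> ends p" "finite C" "(\<lambda>x. x n) ` C = (\<lambda>x. x n) ` ends p"
      using finite_transversal[OF order_refl] by metis
    have "ends p \<subseteq> (\<Union>x\<in>C. mball x \<epsilon>)"
    proof
      fix y assume y: "y \<in> ends p"
      then have "y n \<in> (\<lambda>x. x n) ` C" using C(3) by blast
      then obtain x where "x \<in> C" "x n = y n" by force
      then show "y \<in> (\<Union>x\<in>C. mball x \<epsilon>)"
        using y C(1) ends_dist_less_iff[OF _ y \<open>0 < \<epsilon>\<close>, of x] by (auto simp: n_def)
    qed
    with C show "\<exists>K. finite K \<and> K \<subseteq> ends p \<and> ends p \<subseteq> (\<Union>x\<in>K. mball x \<epsilon>)" by blast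
  qed
  \<comment> \<open>For a Cauchy sequence each label is eventually constant, and the sequence of
    eventual labels is the limit.\<close>
  moreover have mcomplete
    unfolding mcomplete_def
  proof (intro allI impI)
    fix \<sigma> assume "MCauchy \<sigma>"
    then have \<sigma>: "\<sigma> i \<in> ends p" for i by (auto simp: MCauchy_def)
    have "\<exists>I. \<forall>i\<ge>I. \<sigma> i n = \<sigma> I n" for n
    proof -
      \<comment> \<open>Using \<open>Suc n\<close> instead of \<open>n\<close> keeps the radius
        positive for \<open>n = 0\<close>; agreement at level \<open>Suc n\<close> passes down to
        \<open>n\<close>.\<close>
      have pos: "0 < 1 / real (Suc n)" by simp
      have "\<exists>I. \<forall>i j. I \<le> i \<longrightarrow> I \<le> j \<longrightarrow> ends_dist (\<sigma> i) (\<sigma> j) < 1 / real (Suc n)"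
        using \<open>MCauchy \<sigma>\<close>[unfolded MCauchy_def, THEN conjunct2, rule_format, OF pos] .
      then obtain I where I: "I \<le> i \<Longrightarrow> I \<le> j \<Longrightarrow> ends_dist (\<sigma> i) (\<sigma> j) < 1 / real (Suc n)" for i j
        by iprover
      have iff: "ends_dist (\<sigma> i) (\<sigma> j) < 1 / real (Suc n) \<longleftrightarrow> \<sigma> i (Suc n) = \<sigma> j (Suc n)" for i j
      proof -
        have "nat \<lfloor>1 / (1 / real (Suc n))\<rfloor> = Suc n"
          by (simp only: div_by_1 divide_divide_eq_right mult_1 floor_of_nat nat_int)
        then show ?thesis using ends_dist_less_iff[OF \<sigma> \<sigma> pos, of i j] by argo
      qed
      have "\<sigma> i n = \<sigma> I n" if "I \<le> i" for i
      proof (rule ends_eq_Suc[OF \<sigma> \<sigma>])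
        have "ends_dist (\<sigma> i) (\<sigma> I) < 1 / real (Suc n)" 
          using I[OF that order_refl] .
        then show "\<sigma> i (Suc n) = \<sigma> I (Suc n)" unfolding iff .
      qed
      then have "\<forall>i\<ge>I. \<sigma> i n = \<sigma> I n" by iprover
      then show ?thesis ..
    qed
    then obtain I where I: "\<And>n i. I n \<le> i \<Longrightarrow> \<sigma> i n = \<sigma> (I n) n" by metis
    define x where "x = (\<lambda>n. \<sigma> (I n) n)"
    have x_eq: "I n \<le> i \<Longrightarrow> \<sigma> i n = x n" for n i unfolding x_def by (rule I)
    have x: "x \<in> ends p"
      unfolding ends_def
    proof (intro CollectI conjI allI)
      show "x 0 = 0" by (simp add: x_def ends_0[OF \<sigma>])
      show "x (Suc n) = x n \<or> (x (Suc n) = Suc n \<and> x n = p (Suc n))" for n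
        \<comment> \<open>An index past both thresholds shows the labels of levels \<open>n\<close>
          and \<open>Suc n\<close> on a single end, from which \<open>x\<close> inherits the
          branching rule.\<close>
        using ends_Suc[OF \<sigma>, of "max (I n) (I (Suc n))" n] by (simp add: x_eq)
    qed
    have "\<forall>\<^sub>F i in sequentially. ends_dist (\<sigma> i) x < \<epsilon>" if "0 < \<epsilon>" for \<epsilon>
      using eventually_ge_at_top[of "I (nat \<lfloor>1/\<epsilon>\<rfloor>)"]
      by eventually_elim (simp add: ends_dist_less_iff[OF \<sigma> x that] x_eq)
    then have "limitin mtopology \<sigma> x sequentially"
      using x \<sigma> by (simp add: limitin_metric)
    then show "\<exists>x. limitin mtopology \<sigma> x sequentially" by blast
  qed
  ultimately show ?thesis
    by (simp add: ends_metric_def compact_space_eq_mcomplete_mtotally_bounded)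
qed

section \<open>Dimension 1 of the whole space\<close>

lemma ends_label_exists:
  assumes p: "\<And>n. 0 < n \<Longrightarrow> p n < n"
  shows "\<exists>x\<in>ends p. \<forall>n\<ge>l. x n = l"
proof (induction l rule: less_induct)
  case (less l)
  show ?case
  proof (cases "l = 0")
    case True
    then show ?thesis by (intro bexI[of _ "\<lambda>_. 0"]) (auto simp: ends_def)
  next
    case False
    then have "p l < l" using p by blast
    then obtain y where y: "y \<in> ends p" "\<forall>n\<ge>p l. y n = p l" using less by blast
    \<comment> \<open>Follow the end with final label \<open>p l\<close> up to level
      \<open>l - 1\<close>, where \<open>p l < l\<close> guarantees that this label is already
      reached, and turn into the new branch at level \<open>l\<close>.\<close>
    have "(\<lambda>n. if n < l then y n else l) \<in> ends p"
      unfolding ends_def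
    proof (intro CollectI conjI allI)
      show "(if 0 < l then y 0 else l) = 0" using False ends_0[OF y(1)] by simp
    next
      fix n
      consider "Suc n < l" | "Suc n = l" | "l \<le> n" by linarith
      then show "(if Suc n < l then y (Suc n) else l) = (if n < l then y n else l) \<or>
          (if Suc n < l then y (Suc n) else l) = Suc n \<and>
          (if n < l then y n else l) = p (Suc n)"
      proof cases
        case 1
        then show ?thesis using ends_Suc[OF y(1), of n] by simp
      next
        case 2
        then have "p l \<le> n" using \<open>p l < l\<close> by linarith
        then show ?thesis using 2 y(2) by auto
      qed simp
    qed
    then show ?thesis by (rule bexI[rotated]) auto
  qed
qed

lemma labels_ends:
  assumes "\<And>n. 0 < n \<Longrightarrow> p n < n"
  shows "(\<lambda>x. x n) ` ends p = {..n}"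
proof
  show "(\<lambda>x. x n) ` ends p \<subseteq> {..n}" using ends_le by fastforce
  show "{..n} \<subseteq> (\<lambda>x. x n) ` ends p"
  proof
    fix l assume "l \<in> {..n}"
    then show "l \<in> (\<lambda>x. x n) ` ends p" using ends_label_exists[of p l] assms by force
  qed
qed

text \<open>Level \<open>n\<close> has \<open>n + 1\<close> nodes whichever nodes branch, so the
  covering number is asymptotic to \<open>1 / \<epsilon>\<close>. The choice of \<open>p\<close>
  stays free for controlling closed subsets.\<close>

lemma lower_minkowski_dim_ends:
  assumes p: "\<And>n. 0 < n \<Longrightarrow> p n < n"
  shows "lower_minkowski_dim (ends_metric p) = 1"
proof -
  have "covering_number (ends_metric p) \<epsilon> = Suc (nat \<lfloor>1/\<epsilon>\<rfloor>)" if "0 < \<epsilon>" for \<epsilon>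
    using covering_number_ends[OF order_refl that, of p] submetric_mspace[of "ends_metric p"]
    by (simp add: labels_ends[OF p])
  then have "\<forall>\<^sub>F \<epsilon> in at_right 0. covering_number (ends_metric p) \<epsilon> = Suc (nat \<lfloor>1/\<epsilon>\<rfloor>)"
    using eventually_at_right_less[of "0::real"] by (auto elim: eventually_mono)
  then have eq: "\<forall>\<^sub>F \<epsilon> in at_right 0.
      ln (real_of_int (\<lfloor>1/\<epsilon>\<rfloor> + 1)) / ln (1/\<epsilon>) = ln (real (covering_number (ends_metric p) \<epsilon>)) / ln (1/\<epsilon>)"
    using eventually_at_right_less[of "0::real"]
    by eventually_elim (simp add: add.commute)
  have "((\<lambda>\<epsilon>::real. ln (real_of_int (\<lfloor>1/\<epsilon>\<rfloor> + 1)) / ln (1/\<epsilon>)) \<longlongrightarrow> 1) (at_right 0)"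
    by real_asymp
  then have "((\<lambda>\<epsilon>. ln (real (covering_number (ends_metric p) \<epsilon>)) / ln (1/\<epsilon>)) \<longlongrightarrow> 1) (at_right 0)"
    using eq by (rule Lim_transform_eventually)
  then have "Liminf (at_right 0)
      (\<lambda>\<epsilon>. ereal (ln (real (covering_number (ends_metric p) \<epsilon>)) / ln (1/\<epsilon>))) = ereal 1"
    by (intro lim_imp_Liminf) (auto intro: tendsto_ereal)
  moreover have "ends p \<noteq> {}" using labels_ends[OF p, of 0] by auto
  ultimately show ?thesis by (simp add: lower_minkowski_dim_def one_ereal_def)
qed

section \<open>Criteria for dimension 0\<close>

lemma lower_minkowski_dim_ends_subset_eq_0:
  assumes A: "A \<subseteq> ends p"
    and sparse: "\<And>c N. 0 < c \<Longrightarrow> \<exists>n>N. ln (real (card ((\<lambda>x. x n) ` A))) \<le> c * ln (real n)"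
  shows "lower_minkowski_dim (submetric (ends_metric p) A) = 0"
proof (cases "A = {}")
  case True
  then show ?thesis by (simp add: lower_minkowski_dim_def)
next
  case False
  let ?f = "\<lambda>\<epsilon>. ln (real (covering_number (submetric (ends_metric p) A) \<epsilon>)) / ln (1/\<epsilon>)"
  \<comment> \<open>Covers \<open>k = 0\<close> as well, where \<open>ln 0\<close> is
    \<open>0\<close> by convention.\<close>
  have nonneg: "0 \<le> ln (real k)" for k :: nat by (cases k) auto
  have "\<forall>\<^sub>F \<epsilon> in at_right (0::real). \<epsilon> < 1"
    by (rule eventually_at_right_real[THEN eventually_mono]) auto
  then have "\<forall>\<^sub>F \<epsilon> in at_right 0. 0 \<le> ereal (?f \<epsilon>)"
    using eventually_at_right_less[of "0::real"]
    by eventually_elim (simp add: nonneg)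
  then have lower: "0 \<le> Liminf (at_right 0) (\<lambda>\<epsilon>. ereal (?f \<epsilon>))" by (rule Liminf_bounded)
  \<comment> \<open>A positive lower limit would keep the quotient above some \<open>c > 0\<close>
    at all small scales; \<open>sparse\<close> supplies a scale \<open>1 / n\<close> violating
    this.\<close>
  have "\<not> 0 < Liminf (at_right 0) (\<lambda>\<epsilon>. ereal (?f \<epsilon>))"
  proof
    assume "0 < Liminf (at_right 0) (\<lambda>\<epsilon>. ereal (?f \<epsilon>))"
    then obtain c where c: "0 < ereal c" "ereal c < Liminf (at_right 0) (\<lambda>\<epsilon>. ereal (?f \<epsilon>))"
      using ereal_dense2 by blast
    from less_LiminfD[OF c(2)] have "\<forall>\<^sub>F \<epsilon> in at_right 0. c < ?f \<epsilon>" by simp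
    then obtain b where b: "0 < b" "\<And>\<epsilon>. 0 < \<epsilon> \<Longrightarrow> \<epsilon> < b \<Longrightarrow> c < ?f \<epsilon>"
      unfolding eventually_at_right_field by blast
    \<comment> \<open>Exceeding \<open>1\<close> makes \<open>ln n\<close> positive, and exceeding
      \<open>1 / b\<close> puts the scale \<open>1 / n\<close> below \<open>b\<close>.\<close>
    obtain n where n: "max 1 (nat \<lceil>1/b\<rceil>) < n"
      "ln (real (card ((\<lambda>x. x n) ` A))) \<le> c * ln (real n)"
      using sparse c(1) by (metis ereal_less(2))
    have "1/b < real n" using n(1) by linarith
    then have "1 / real n < b" using n(1) b(1) by (simp add: field_simps)
    then have "c < ?f (1 / real n)" using n(1) by (intro b(2)) simp_all
    moreover have "?f (1 / real n) = ln (real (card ((\<lambda>x. x n) ` A))) / ln (real n)"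
      using covering_number_ends[OF A, of "1 / real n"] n(1) by simp
    moreover have "0 < ln (real n)" using n(1) by simp
    ultimately show False using n(2) by (simp add: field_simps)
  qed
  with lower have "Liminf (at_right 0) (\<lambda>\<epsilon>. ereal (?f \<epsilon>)) = 0" by auto
  moreover have "A \<inter> ends p \<noteq> {}" using False A by blast
  ultimately show ?thesis by (simp add: lower_minkowski_dim_def)
qed

text \<open>The open complement contains a ball, which is the set of all ends through a node; that
  node is the one missed by \<open>A\<close>.\<close>

lemma closedin_ends_misses_label:
  assumes "closedin (mtopology_of (ends_metric p)) A" "A \<subset> ends p"
  obtains N l where "l \<le> N" "\<forall>y\<in>A. y N \<noteq> l"
proof -
  interpret Metric_space "ends p" ends_dist by (rule Metric_space_ends)
  have "closedin mtopology A" using assms(1) by (simp add: ends_metric_def)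
  moreover obtain x where x: "x \<in> ends p - A" using assms(2) by blast
  ultimately obtain r where r: "0 < r" "disjnt A (mball x r)" unfolding closedin_metric by blast
  show thesis
  proof (rule that[of "x (nat \<lfloor>1/r\<rfloor>)" "nat \<lfloor>1/r\<rfloor>"])
    show "x (nat \<lfloor>1/r\<rfloor>) \<le> nat \<lfloor>1/r\<rfloor>" using x ends_le by blast
    show "\<forall>y\<in>A. y (nat \<lfloor>1/r\<rfloor>) \<noteq> x (nat \<lfloor>1/r\<rfloor>)"
    proof
      fix y assume y: "y \<in> A"
      then have "y \<notin> mball x r" using r(2) by (auto simp: disjnt_def)
      then show "y (nat \<lfloor>1/r\<rfloor>) \<noteq> x (nat \<lfloor>1/r\<rfloor>)"
        using y x assms(2) ends_dist_less_iff[OF _ _ r(1), of x p y] by auto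
    qed
  qed
qed

text \<open>Label \<open>l\<close> cannot be acquired after level \<open>l\<close>, so an end
  without it at \<open>N\<close> never carries it later; when all branches of the stage split off
  \<open>l\<close>, such an end has no place to turn.\<close>

lemma ends_constant_on_stage:
  assumes x: "x \<in> ends p" and "x N \<noteq> l" "l \<le> N" "N \<le> m" "m \<le> n"
    and stage: "\<And>i. m < i \<Longrightarrow> i \<le> n \<Longrightarrow> p i = l"
  shows "x n = x m"
  using \<open>m \<le> n\<close> stage
proof (induction rule: dec_induct)
  case (step k)
  have "x k \<noteq> l" using ends_label_stable[OF x, of k l N] step assms(2-4) by auto
  then show ?case using ends_Suc[OF x, of k] step by auto
qed simp

section \<open>Choice of the branching nodes in stages\<close>

definition stage_end :: "nat \<Rightarrow> nat" where
  "stage_end k = 2 ^ fact k"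

text \<open>The stage number is decoded by Cantor pairing: the first component is the node that
  branches, and the free second component makes every label recur in infinitely many stages.\<close>

definition stage_parent :: "nat \<Rightarrow> nat" where
  "stage_parent n = fst (prod_decode (LEAST k. n \<le> stage_end k))"

lemma stage_end_mono: "i \<le> j \<Longrightarrow> stage_end i \<le> stage_end j"
  by (simp add: stage_end_def fact_mono)

lemma less_stage_end: "k < stage_end k"
proof -
  have "k < 2 ^ k" by (rule less_exp)
  also have "\<dots> \<le> stage_end k" by (simp add: stage_end_def fact_ge_self)
  finally show ?thesis .
qed

text \<open>By \<open>k < stage_end k\<close> the stage number of \<open>n\<close> is below
  \<open>n\<close>, and a component of a pair never exceeds its code. So the branching node exists
  one level earlier.\<close>

lemma stage_parent_less: "0 < n \<Longrightarrow> stage_parent n < n"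
proof -
  assume "0 < n"
  then have "n \<le> stage_end (n - 1)" using less_stage_end[of "n - 1"] by simp
  then have "(LEAST k. n \<le> stage_end k) \<le> n - 1" by (rule Least_le)
  moreover have "fst (prod_decode i) \<le> i" for i
    by (metis le_prod_encode_1 prod.collapse prod_decode_inverse)
  ultimately show ?thesis
    using \<open>0 < n\<close> unfolding stage_parent_def
    by (metis Suc_pred' le_trans less_Suc_eq_le)
qed

lemma stage_parent_eq:
  assumes "stage_end k < i" "i \<le> stage_end (Suc k)"
  shows "stage_parent i = fst (prod_decode (Suc k))"
proof -
  have "(LEAST j. i \<le> stage_end j) = Suc k"
  proof (rule Least_equality)
    fix j assume "i \<le> stage_end j"
    then show "Suc k \<le> j" using assms(1) stage_end_mono[of j k] by (meson leD le_less_trans not_less_eq_eq order.trans)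
  qed (rule assms)
  then show ?thesis by (simp add: stage_parent_def)
qed

text \<open>The exponent \<open>fact k\<close> makes \<open>ln (stage_end (Suc k))\<close> equal to
  \<open>k + 1\<close> times \<open>ln (stage_end k)\<close>; the factor \<open>2\<close> pays for
  \<open>stage_end k + 1\<close>, which is at most \<open>stage_end k ^ 2\<close>.\<close>

lemma ln_stage_end_Suc: "real (Suc k) * ln (real (stage_end k + 1)) \<le> 2 * ln (real (stage_end (Suc k)))"
proof -
  have "real (stage_end k + 1) \<le> real (stage_end k) ^ 2"
  proof -
    have "2 \<le> stage_end k" unfolding stage_end_def
      by (metis One_nat_def fact_ge_1 numeral_le_one_iff one_le_numeral power_increasing power_one_right)
    then have "stage_end k + 1 \<le> stage_end k * 2" by simp
    also have "\<dots> \<le> stage_end k * stage_end k" using \<open>2 \<le> stage_end k\<close> by simp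
    finally show ?thesis by (metis of_nat_le_iff of_nat_power power2_eq_square)
  qed
  then have "ln (real (stage_end k + 1)) \<le> ln (real (stage_end k) ^ 2)"
    by (rule ln_mono) (simp only: of_nat_0_less_iff add_gr_0 zero_less_one simp_thms)
  also have "\<dots> = 2 * (fact k * ln 2)"
    by (simp add: stage_end_def ln_realpow)
  finally have "real (Suc k) * ln (real (stage_end k + 1)) \<le> real (Suc k) * (2 * (fact k * ln 2))"
    by (rule mult_left_mono) simp
  also have "\<dots> = 2 * ln (real (stage_end (Suc k)))"
    by (simp add: stage_end_def ln_realpow algebra_simps)
  finally show ?thesis .
qed

lemma lower_minkowski_dim_proper_closed:
  assumes "closedin (mtopology_of (ends_metric stage_parent)) A" "A \<subset> ends stage_parent"
  shows "lower_minkowski_dim (submetric (ends_metric stage_parent) A) = 0"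
proof (rule lower_minkowski_dim_ends_subset_eq_0)
  show A: "A \<subseteq> ends stage_parent" using assms(2) by blast
  obtain N l where N: "l \<le> N" "\<forall>y\<in>A. y N \<noteq> l"
    using closedin_ends_misses_label[OF assms] .
  fix c :: real and M :: nat
  assume "0 < c"
  \<comment> \<open>The second component \<open>t\<close> picks a late stage devoted to
    \<open>l\<close>: a code is at least \<open>t\<close>, so \<open>k\<close> is at least
    \<open>N\<close> and \<open>M\<close>, and \<open>Suc k\<close> at least \<open>2 / c\<close>.
    The outer \<open>Suc\<close> also makes the code positive, hence of the form
    \<open>Suc k\<close>.\<close>
  define t where "t = Suc (max (max N M) (nat \<lceil>2 / c\<rceil>))"
  obtain k where k: "Suc k = prod_encode (l, t)"
    using le_prod_encode_2[of t l] by (metis Suc_le_D t_def)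
  have "t \<le> Suc k" by (simp add: k le_prod_encode_2)
  then have "N \<le> k" "M \<le> k" "2 / c \<le> real (Suc k)" unfolding t_def by linarith+
  let ?n = "stage_end (Suc k)"
  have "fst (prod_decode (Suc k)) = l" by (simp add: k)
  then have const: "y ?n = y (stage_end k)" if "y \<in> A" for y
    using ends_constant_on_stage[of y stage_parent N l "stage_end k" ?n] that A N
      stage_parent_eq[of k] stage_end_mono[of k "Suc k"] less_stage_end[of k] \<open>N \<le> k\<close>
    by auto
  \<comment> \<open>No end of \<open>A\<close> turns during the stage, so the labels at level
    \<open>?n\<close> are still those at level \<open>stage_end k\<close>.\<close>
  then have "(\<lambda>x. x ?n) ` A \<subseteq> {..stage_end k}"
    using A ends_le by (intro image_subsetI) (metis atMost_iff subsetD)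
  then have "card ((\<lambda>x. x ?n) ` A) \<le> stage_end k + 1"
    using card_mono[of "{..stage_end k}"] by fastforce
  then have "ln (real (card ((\<lambda>x. x ?n) ` A))) \<le> ln (real (stage_end k + 1))"
    by (cases "card ((\<lambda>x. x ?n) ` A)") auto
  also have "\<dots> \<le> c * ln (real ?n)"
  proof -
    have "2 * ln (real (stage_end k + 1)) \<le> c * (real (Suc k) * ln (real (stage_end k + 1)))"
    proof -
      have "2 \<le> c * real (Suc k)" using \<open>2 / c \<le> real (Suc k)\<close> \<open>0 < c\<close> by (simp add: field_simps)
      then show ?thesis
        using mult_right_mono[of 2 "c * real (Suc k)" "ln (real (stage_end k + 1))"]
        by (simp add: mult.assoc)
    qed
    also have "\<dots> \<le> c * (2 * ln (real ?n))"
      using ln_stage_end_Suc \<open>0 < c\<close> by (simp add: mult_left_mono)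
    finally show ?thesis by simp
  qed
  finally show "\<exists>n>M. ln (real (card ((\<lambda>x. x n) ` A))) \<le> c * ln (real n)"
    using less_stage_end[of "Suc k"] \<open>M \<le> k\<close> by (intro exI[of _ ?n]) simp
qed

theorem proposition7p1:
  shows "\<exists>X :: continuum_metric.
           compact_space (mtopology_of X) \<and>
           lower_minkowski_dim X = 1 \<and>
           (\<forall>A. closedin (mtopology_of X) A \<and> A \<subset> mspace X \<longrightarrow>
                lower_minkowski_dim (submetric X A) = 0)"
  using compact_space_ends lower_minkowski_dim_ends[OF stage_parent_less]
    lower_minkowski_dim_proper_closed
  by (intro exI[of _ "ends_metric stage_parent"]) auto

end
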